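(* Let $k$ be a field of characteristic $0$ and let $\mathcal C\subset\mathbb P^2$ (coordinates $(a_0:a_1:a_2)$) be the rational cubic curve that is the image of \[\gamma:\mathbb P^1\to\mathbb P^2,\quad(\alpha:\beta)\mapsto(3\alpha\beta^2+\beta^3:3\alpha^2\beta:\alpha^3).\] Then $\mathcal C$ is a cuspidal cubic curve given by the equation \[27a_0a_2^2-9a_1^2a_2-a_1^3=0.\] Its cusp is $\mathcal P=(1:0:0)$ and its unique flex point is $\mathcal Q=(2:-3:1)$. The line through $\mathcal P$ and $\mathcal Q$ is the line $\ell_1:\ a_1+3a_2=0$. Moreover, the line $\ell_2:\ a_2=0$ is the unique line meeting $\mathcal C$ at $\mathcal P$ with multiplicity three.
   Context: A flex point of a plane curve is a smooth point at which the tangent line meets the curve with intersection multiplicity at least $3$. *)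

theory Defs
  imports
    "HOL-Analysis.Analysis"
    "HOL-Library.Poly_Mapping"
    "HOL-Library.Extended_Nat"
    "HOL-Computational_Algebra.Computational_Algebra"
begin

section \<open>Projective spaces\<close>

definition proj_rel :: "'k::field ^ 'n \<Rightarrow> 'k ^ 'n \<Rightarrow> bool" where
  "proj_rel u v \<longleftrightarrow> u \<noteq> 0 \<and> v \<noteq> 0 \<and> (\<exists>c. c \<noteq> 0 \<and> v = c *s u)"

lemma part_equivp_proj_rel: "part_equivp (proj_rel :: 'k::field ^ 'n \<Rightarrow> 'k ^ 'n \<Rightarrow> bool)"
proof (rule part_equivpI)
  have "proj_rel (vec 1 :: 'k ^ 'n) (vec 1)"
    by (auto simp: proj_rel_def vec_eq_iff intro!: exI[of _ 1])
  then show "\<exists>x :: 'k ^ 'n. proj_rel x x" by blast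
  show "symp (proj_rel :: 'k ^ 'n \<Rightarrow> 'k ^ 'n \<Rightarrow> bool)"
  proof (rule sympI)
    fix u v :: "'k ^ 'n"
    assume "proj_rel u v"
    then obtain c where c: "u \<noteq> 0" "v \<noteq> 0" "c \<noteq> 0" "v = c *s u"
      by (auto simp: proj_rel_def)
    then have "u = inverse c *s v" by (simp add: vec_eq_iff)
    with c show "proj_rel v u" unfolding proj_rel_def
      by (metis nonzero_imp_inverse_nonzero)
  qed
  show "transp (proj_rel :: 'k ^ 'n \<Rightarrow> 'k ^ 'n \<Rightarrow> bool)"
  proof (rule transpI)
    fix u v w :: "'k ^ 'n"
    assume "proj_rel u v" "proj_rel v w"
    then obtain c d where "u \<noteq> 0" "w \<noteq> 0" "c \<noteq> 0" "v = c *s u" "d \<noteq> 0" "w = d *s v"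
      by (auto simp: proj_rel_def)
    then show "proj_rel u w" unfolding proj_rel_def
      by (auto simp: vector_smult_assoc intro!: exI[of _ "d * c"])
  qed
qed

text \<open>The \<open>'k\<close>-rational points of the projective space with homogeneous coordinates
  indexed by \<open>'n\<close>. The value of \<open>mk_proj\<close> at the zero vector is meaningless.\<close>

quotient_type (overloaded) ('k, 'n) proj = "('k::field) ^ ('n::finite)" / partial: proj_rel
  morphisms rep_proj mk_proj
  by (rule part_equivp_proj_rel)

type_synonym 'k proj_line = "('k, 2) proj"
type_synonym 'k proj_plane = "('k, 3) proj"

text \<open>A line in the projective plane is represented by the point of the dual plane
  given by the coefficients of its equation.\<close>

type_synonym 'k line = "('k, 3) proj"

definition coords :: "('k::field, 'n::finite) proj \<Rightarrow> ('k ^ 'n) set" where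
  "coords P = {v. v \<noteq> 0 \<and> mk_proj v = P}"

definition lies_on :: "'k::field proj_plane \<Rightarrow> 'k line \<Rightarrow> bool" where
  "lies_on P L \<longleftrightarrow> (\<forall>v\<in>coords P. \<forall>l\<in>coords L. (\<Sum>i\<in>UNIV. l $ i * v $ i) = 0)"

section \<open>Ternary polynomials\<close>

text \<open>The polynomial ring in three variables, as the monoid algebra of the monomials.
  The index type \<open>3\<close> has the elements \<open>1\<close>, \<open>2\<close>, \<open>3\<close>, so the homogeneous
  coordinates \<open>a\<^sub>0\<close>, \<open>a\<^sub>1\<close>, \<open>a\<^sub>2\<close> carry the indices \<open>1\<close>, \<open>2\<close>, \<open>3\<close>.\<close>

type_synonym 'k poly3 = "(3 \<Rightarrow>\<^sub>0 nat) \<Rightarrow>\<^sub>0 'k"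

definition variable :: "3 \<Rightarrow> 'k::field poly3" where
  "variable i = Poly_Mapping.single (Poly_Mapping.single i 1) 1"

definition homogeneous :: "nat \<Rightarrow> 'k::field poly3 \<Rightarrow> bool" where
  "homogeneous d F \<longleftrightarrow> (\<forall>m\<in>Poly_Mapping.keys F. (\<Sum>i\<in>UNIV. Poly_Mapping.lookup m i) = d)"

definition eval3 :: "'k::field poly3 \<Rightarrow> 'k ^ 3 \<Rightarrow> 'k" where
  "eval3 F v = (\<Sum>m\<in>Poly_Mapping.keys F.
     Poly_Mapping.lookup F m * (\<Prod>i\<in>UNIV. v $ i ^ Poly_Mapping.lookup m i))"

definition pdiff :: "3 \<Rightarrow> 'k::field poly3 \<Rightarrow> 'k poly3" where
  "pdiff i F = (\<Sum>m\<in>Poly_Mapping.keys F.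
     Poly_Mapping.single (m - Poly_Mapping.single i 1)
       (of_nat (Poly_Mapping.lookup m i) * Poly_Mapping.lookup F m))"

definition gradient :: "'k::field poly3 \<Rightarrow> 'k ^ 3 \<Rightarrow> 'k ^ 3" where
  "gradient F v = (\<chi> i. eval3 (pdiff i F) v)"

text \<open>The univariate polynomial \<open>F (p + t q)\<close> in \<open>t\<close>.\<close>

definition restrict_line :: "'k::field poly3 \<Rightarrow> 'k ^ 3 \<Rightarrow> 'k ^ 3 \<Rightarrow> 'k poly" where
  "restrict_line F p q = (\<Sum>m\<in>Poly_Mapping.keys F.
     smult (Poly_Mapping.lookup F m) (\<Prod>i\<in>UNIV. [:p $ i, q $ i:] ^ Poly_Mapping.lookup m i))"

section \<open>Plane curves\<close>

text \<open>A plane curve is handled through its homogeneous equation \<open>F\<close>. For homogeneous \<open>F\<close>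
  none of the notions below depends on the choice of homogeneous coordinates.\<close>

definition zero_locus :: "'k::field poly3 \<Rightarrow> 'k proj_plane set" where
  "zero_locus F = {P. \<forall>v\<in>coords P. eval3 F v = 0}"

definition vanishing_ideal :: "'k::field proj_plane set \<Rightarrow> 'k poly3 set" where
  "vanishing_ideal C = {G. \<forall>P\<in>C. \<forall>v\<in>coords P. eval3 G v = 0}"

text \<open>Besides the equality of point sets, the equation has to generate the homogeneous
  ideal of the curve, so that it determines multiplicities.\<close>

definition curve_given_by :: "'k::field proj_plane set \<Rightarrow> 'k poly3 \<Rightarrow> bool" where
  "curve_given_by C F \<longleftrightarrow>
     (\<exists>d. homogeneous d F) \<and> C = zero_locus F \<and> vanishing_ideal C = {G. F dvd G}"

definition smooth_point :: "'k::field poly3 \<Rightarrow> 'k proj_plane \<Rightarrow> bool" where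
  "smooth_point F P \<longleftrightarrow> P \<in> zero_locus F \<and> (\<forall>v\<in>coords P. gradient F v \<noteq> 0)"

definition singular_point :: "'k::field poly3 \<Rightarrow> 'k proj_plane \<Rightarrow> bool" where
  "singular_point F P \<longleftrightarrow> P \<in> zero_locus F \<and> (\<forall>v\<in>coords P. gradient F v = 0)"

text \<open>At a smooth point \<open>v\<close> the tangent line has the equation \<open>\<Sum>i. \<partial>\<^sub>i F (v) a\<^sub>i = 0\<close>.\<close>

definition tangent_line :: "'k::field poly3 \<Rightarrow> 'k proj_plane \<Rightarrow> 'k line \<Rightarrow> bool" where
  "tangent_line F P L \<longleftrightarrow> smooth_point F P \<and> (\<forall>v\<in>coords P. L = mk_proj (gradient F v))"

definition vanishing_order :: "'k::field poly \<Rightarrow> enat" where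
  "vanishing_order f = (if f = 0 then \<infinity> else enat (order 0 f))"

text \<open>The multiplicity at \<open>P\<close> of the restriction of \<open>F\<close> to \<open>L\<close>, where \<open>L\<close> is parametrized
  near \<open>P\<close> by \<open>t \<mapsto> p + t q\<close> with \<open>q\<close> another point of \<open>L\<close>. For homogeneous \<open>F\<close> all such
  parametrizations give the same order.\<close>

definition intersection_mult :: "'k::field poly3 \<Rightarrow> 'k line \<Rightarrow> 'k proj_plane \<Rightarrow> enat" where
  "intersection_mult F L P =
     (if lies_on P L
      then THE m. \<exists>Q. Q \<noteq> P \<and> lies_on Q L \<and>
             (\<exists>p\<in>coords P. \<exists>q\<in>coords Q. m = vanishing_order (restrict_line F p q))
      else 0)"

text \<open>At a singular point \<open>v\<close> the quadratic part of the Taylor expansion \<open>F (v + x)\<close> is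
  \<open>(\<Sum>i j. \<partial>\<^sub>i \<partial>\<^sub>j F (v) x\<^sub>i x\<^sub>j) / 2\<close>. The point is a double point whose tangent cone is
  the line \<open>L\<close> counted twice iff this is a nonzero multiple of the square of a linear form
  defining \<open>L\<close>.\<close>

definition double_tangent :: "'k::field poly3 \<Rightarrow> 'k proj_plane \<Rightarrow> 'k line \<Rightarrow> bool" where
  "double_tangent F P L \<longleftrightarrow> singular_point F P \<and>
     (\<forall>v\<in>coords P. \<forall>l\<in>coords L. \<exists>c. c \<noteq> 0 \<and>
        (\<forall>i j. eval3 (pdiff i (pdiff j F)) v = c * l $ i * l $ j))"

text \<open>An (ordinary) cusp: a double point with a single tangent line, meeting the curve there
  with multiplicity exactly three.\<close>

definition cusp :: "'k::field poly3 \<Rightarrow> 'k proj_plane \<Rightarrow> bool" where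
  "cusp F P \<longleftrightarrow> (\<exists>L. double_tangent F P L \<and> intersection_mult F L P = 3)"

definition flex_point :: "'k::field poly3 \<Rightarrow> 'k proj_plane \<Rightarrow> bool" where
  "flex_point F P \<longleftrightarrow>
     smooth_point F P \<and> (\<exists>L. tangent_line F P L \<and> intersection_mult F L P \<ge> 3)"

definition cuspidal_cubic :: "'k::field poly3 \<Rightarrow> bool" where
  "cuspidal_cubic F \<longleftrightarrow> homogeneous 3 F \<and> irreducible F \<and> (\<exists>P. cusp F P)"

section \<open>The rational cubic\<close>

lift_definition cubic_param :: "'k::field_char_0 proj_line \<Rightarrow> 'k proj_plane" is
  "\<lambda>v :: 'k ^ 2. vector [3 * v $ 1 * (v $ 2)\<^sup>2 + (v $ 2) ^ 3, 3 * (v $ 1)\<^sup>2 * v $ 2, (v $ 1) ^ 3]"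
proof -
  let ?g = "\<lambda>v :: 'k ^ 2.
    vector [3 * v $ 1 * (v $ 2)\<^sup>2 + (v $ 2) ^ 3, 3 * (v $ 1)\<^sup>2 * v $ 2, (v $ 1) ^ 3] :: 'k ^ 3"
  have nz: "?g v \<noteq> 0" if "v \<noteq> 0" for v
    using that by (auto simp: vec_eq_iff forall_2 forall_3 vector_3)
  fix u v :: "'k ^ 2"
  assume "proj_rel u v"
  then obtain c where c: "u \<noteq> 0" "v \<noteq> 0" "c \<noteq> 0" "v = c *s u"
    by (auto simp: proj_rel_def)
  have "?g v = c ^ 3 *s ?g u"
    unfolding c(4)
    by (simp add: vec_eq_iff forall_3 vector_3 algebra_simps power2_eq_square power3_eq_cube)
  with c nz show "proj_rel (?g u) (?g v)"
    unfolding proj_rel_def by (metis power_not_zero)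
qed

definition cubic_equation :: "'k::field_char_0 poly3" where
  "cubic_equation =
     (let a0 = variable 1; a1 = variable 2; a2 = variable 3
      in 27 * a0 * a2\<^sup>2 - 9 * a1\<^sup>2 * a2 - a1 ^ 3)"

end

theory Submission
  imports Defs
begin

text \<open>Besides the cusp \<open>(1 : 0 : 0)\<close>, the points of the curve are \<open>(3 s\<^sup>2 + s\<^sup>3 : 3 s : 1)\<close>, so
  tangent lines and intersection multiplicities can be computed explicitly in terms of \<open>s\<close>.

  For the ideal, the equation is monic up to sign in \<open>a\<^sub>1\<close>, so every polynomial is congruent to one
  of degree at most \<open>2\<close> in \<open>a\<^sub>1\<close>. On \<open>c (3 s\<^sup>2 + s\<^sup>3, 3 s, 1)\<close> a monomial
  \<open>a\<^sub>0\<^sup>i a\<^sub>1\<^sup>j a\<^sub>2\<^sup>k\<close> has leading term a multiple of \<open>c\<^bsup>i+j+k\<^esup> s\<^bsup>3i+j\<^esup>\<close>, and for \<open>j \<le> 2\<close> these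
  are distinct, even after putting \<open>c = s\<^sup>N\<close> with \<open>N\<close> large; hence a reduced polynomial vanishing on the
  curve is zero. Since polynomials in
  \<open>s\<close> have no zero divisors, the equation is prime, hence irreducible.\<close>

section \<open>Preliminaries on finitely supported maps and on vectors of length three\<close>

no_notation fps_nth (infixl \<open>$\<close> 75)

text \<open>Finitely supported maps are finite sums of single terms, so identities additive in a
  polynomial need checking on monomials only.\<close>

lemma poly_mapping_single_add_induct [case_names single add]:
  assumes "\<And>m c. P (Poly_Mapping.single m c)"
    and "\<And>f g. P f \<Longrightarrow> P g \<Longrightarrow> P (f + g)"
  shows "P (f :: 'a \<Rightarrow>\<^sub>0 'b::comm_monoid_add)"
proof (induction f rule: update_induct)
  case const
  \<comment> \<open>The zero map counts as a single term with coefficient 0.\<close>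
  show ?case using assms(1)[of undefined 0] by simp
next
  case (update f a b)
  then have "Poly_Mapping.update a b f = Poly_Mapping.single a b + f"
    by (intro poly_mapping_eqI)
      (auto simp: lookup_update lookup_add lookup_single when_def in_keys_iff)
  with update assms show ?case by simp
qed

lemma distinct_3 [simp]: "(1::3) \<noteq> 2" "(1::3) \<noteq> 3" "(2::3) \<noteq> 3" "(2::3) \<noteq> 1" "(3::3) \<noteq> 1" "(3::3) \<noteq> 2"
  by auto

lemma prod_UNIV_3: "prod f (UNIV :: 3 set) = f 1 * f 2 * f 3"
  for f :: "3 \<Rightarrow> 'a::comm_monoid_mult"
  unfolding UNIV_3 by (simp add: ac_simps)

lemma vec3_eq_iff: "u = v \<longleftrightarrow> u $ 1 = v $ 1 \<and> u $ 2 = v $ 2 \<and> u $ 3 = v $ 3"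
  for u v :: "'a ^ 3"
  by (simp add: vec_eq_iff forall_3)

section \<open>Ternary polynomials\<close>

text \<open>Exponent vectors in explicit coordinates, so that simplification can add, compare and
  differentiate monomials.\<close>

definition mon :: "nat \<Rightarrow> nat \<Rightarrow> nat \<Rightarrow> 3 \<Rightarrow>\<^sub>0 nat" where
  "mon i j k = Poly_Mapping.single 1 i + Poly_Mapping.single 2 j + Poly_Mapping.single 3 k"

lemma lookup_mon [simp]:
  "Poly_Mapping.lookup (mon i j k) 1 = i"
  "Poly_Mapping.lookup (mon i j k) 2 = j"
  "Poly_Mapping.lookup (mon i j k) 3 = k"
  by (simp_all add: mon_def lookup_add lookup_single)

lemma poly_mapping_3_eqI:
  "m = n" if "Poly_Mapping.lookup m 1 = Poly_Mapping.lookup n 1"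
    "Poly_Mapping.lookup m 2 = Poly_Mapping.lookup n 2"
    "Poly_Mapping.lookup m 3 = Poly_Mapping.lookup n 3"
  for m n :: "3 \<Rightarrow>\<^sub>0 nat"
  using that by (intro poly_mapping_eqI) (metis exhaust_3)

lemma mon_exhaust: obtains i j k where "m = mon i j k"
proof
  show "m = mon (Poly_Mapping.lookup m 1) (Poly_Mapping.lookup m 2) (Poly_Mapping.lookup m 3)"
    by (rule poly_mapping_3_eqI) simp_all
qed

lemma mon_add [simp]: "mon i j k + mon i' j' k' = mon (i + i') (j + j') (k + k')"
  by (rule poly_mapping_3_eqI) (simp_all add: lookup_add)

lemma mon_eq_iff [simp]: "mon i j k = mon i' j' k' \<longleftrightarrow> i = i' \<and> j = j' \<and> k = k'"
  by (metis lookup_mon)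

lemma mon_minus_single [simp]:
  "mon i j k - Poly_Mapping.single 1 n = mon (i - n) j k"
  "mon i j k - Poly_Mapping.single 2 n = mon i (j - n) k"
  "mon i j k - Poly_Mapping.single 3 n = mon i j (k - n)"
  by (rule poly_mapping_3_eqI; simp add: minus_poly_mapping.rep_eq lookup_single)+

lemma single_eq_mon:
  "Poly_Mapping.single 1 n = mon n 0 0"
  "Poly_Mapping.single 2 n = mon 0 n 0"
  "Poly_Mapping.single 3 n = mon 0 0 n"
  by (simp_all add: mon_def)

lemma mon_0: "mon 0 0 0 = 0"
  by (simp add: mon_def)

lemma cubic_equation_eq:
  "cubic_equation = Poly_Mapping.single (mon 1 0 2) 27
     + Poly_Mapping.single (mon 0 2 1) (- 9) + Poly_Mapping.single (mon 0 3 0) (- 1)"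
proof -
  have num: "(numeral n :: 'a poly3) = Poly_Mapping.single (mon 0 0 0) (numeral n)" for n
    by (simp add: mon_0)
  show ?thesis
    by (simp add: cubic_equation_def Let_def variable_def single_eq_mon power2_eq_square
        power3_eq_cube num mult_single single_uminus numeral_2_eq_2 numeral_3_eq_3 del: single_numeral)
qed

text \<open>Evaluation at a vector and restriction to a line or arc are both substitutions extending
  a homomorphism of coefficients: the identity for values, constant polynomials for restrictions.
  The algebra is done once for both.\<close>

locale coeff_hom =
  fixes h :: "'k::field \<Rightarrow> 'r::comm_ring_1"
  assumes h_0: "h 0 = 0" and h_1: "h 1 = 1"
    and h_add: "h (a + b) = h a + h b" and h_mult: "h (a * b) = h a * h b"
begin

definition subst3 :: "(3 \<Rightarrow> 'r) \<Rightarrow> 'k poly3 \<Rightarrow> 'r" where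
  "subst3 x F = (\<Sum>m\<in>Poly_Mapping.keys F.
     h (Poly_Mapping.lookup F m) * (\<Prod>i\<in>UNIV. x i ^ Poly_Mapping.lookup m i))"

lemma h_uminus: "h (- a) = - h a"
  using h_add[of a "- a"] by (simp add: h_0 eq_neg_iff_add_eq_0 add.commute)

lemma h_numeral: "h (numeral n) = numeral n"
proof -
  have "h (of_nat n) = of_nat n" for n
    by (induction n) (simp_all add: h_0 h_1 h_add)
  from this[of "numeral n"] show ?thesis by simp
qed

lemma subst3_single:
  "subst3 x (Poly_Mapping.single m c) = h c * (\<Prod>i\<in>UNIV. x i ^ Poly_Mapping.lookup m i)"
  by (simp add: subst3_def h_0)

lemma subst3_mon: "subst3 x (Poly_Mapping.single (mon i j k) c) = h c * x 1 ^ i * x 2 ^ j * x 3 ^ k"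
  by (simp add: subst3_single prod_UNIV_3 mult.assoc)

lemma subst3_add: "subst3 x (F + G) = subst3 x F + subst3 x G"
  unfolding subst3_def by (rule setsum_keys_plus_distrib) (simp_all add: h_0 h_add algebra_simps)

lemma subst3_0: "subst3 x 0 = 0"
  by (simp add: subst3_def)

text \<open>Both sides are additive in \<open>F\<close> and in \<open>G\<close>; on monomials,
  exponents add.\<close>

lemma subst3_mult: "subst3 x (F * G) = subst3 x F * subst3 x G"
proof (induction F rule: poly_mapping_single_add_induct)
  case (single m c)
  show ?case
    by (induction G rule: poly_mapping_single_add_induct)
      (simp_all add: mult_single subst3_single h_mult lookup_add power_add prod.distrib
        distrib_left distrib_right subst3_add ac_simps)
qed (simp add: distrib_right subst3_add)

lemma subst3_1: "subst3 x 1 = 1"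
  using subst3_mon[of x 0 0 0 1] by (simp add: mon_0 h_1)

end

lemma subst3_cubic_equation:
  assumes "coeff_hom h"
  shows "coeff_hom.subst3 h x cubic_equation = 27 * x 1 * (x 3)\<^sup>2 - 9 * (x 2)\<^sup>2 * x 3 - x 2 ^ 3"
proof -
  interpret coeff_hom h by fact
  show ?thesis
    by (simp add: cubic_equation_eq subst3_add subst3_mon h_uminus h_numeral h_1)
qed

interpretation eval3: coeff_hom "\<lambda>c. c"
  by unfold_locales simp_all

interpretation poly_hom: coeff_hom "\<lambda>c. [:c:]"
  by unfold_locales (simp_all add: pCons_one)

lemma eval3_eq: "eval3 F v = eval3.subst3 (($) v) F"
  by (simp add: eval3_def eval3.subst3_def)

lemma restrict_line_eq: "restrict_line F p q = poly_hom.subst3 (\<lambda>i. [:p $ i, q $ i:]) F"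
  by (simp add: restrict_line_def poly_hom.subst3_def)

lemma poly_subst3: "poly (poly_hom.subst3 x F) s = eval3 F (\<chi> i. poly (x i) s)"
  by (simp add: poly_hom.subst3_def eval3_def poly_sum poly_prod)

section \<open>Formal derivatives and explicit formulas for the cubic\<close>

lemma pdiff_add: "pdiff i (F + G) = pdiff i F + pdiff i G"
  unfolding pdiff_def by (rule setsum_keys_plus_distrib) (simp_all add: algebra_simps single_add)

lemma pdiff_single:
  "pdiff i (Poly_Mapping.single m c) =
     Poly_Mapping.single (m - Poly_Mapping.single i 1) (of_nat (Poly_Mapping.lookup m i) * c)"
  by (simp add: pdiff_def)

lemma eval3_cubic_equation:
  "eval3 cubic_equation v = 27 * v $ 1 * (v $ 3)\<^sup>2 - 9 * (v $ 2)\<^sup>2 * v $ 3 - v $ 2 ^ 3"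
  by (simp add: eval3_eq subst3_cubic_equation eval3.coeff_hom_axioms)

lemma restrict_line_cubic_equation:
  "restrict_line cubic_equation p q = 27 * [:p $ 1, q $ 1:] * [:p $ 3, q $ 3:]\<^sup>2
     - 9 * [:p $ 2, q $ 2:]\<^sup>2 * [:p $ 3, q $ 3:] - [:p $ 2, q $ 2:] ^ 3"
  by (simp add: restrict_line_eq subst3_cubic_equation poly_hom.coeff_hom_axioms)

lemma gradient_cubic_equation:
  "gradient cubic_equation v =
     vector [27 * (v $ 3)\<^sup>2, - 18 * v $ 2 * v $ 3 - 3 * (v $ 2)\<^sup>2, 54 * v $ 1 * v $ 3 - 9 * (v $ 2)\<^sup>2]"
  by (simp add: vec3_eq_iff gradient_def cubic_equation_eq pdiff_add pdiff_single eval3_eq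
      eval3.subst3_0 eval3.subst3_add eval3.subst3_mon vector_3)

text \<open>Only the monomial a0 a2^2 has degree below 3 in a1, a2, so only its second derivative in
  a2 survives.\<close>

lemma hessian_cubic_equation_cusp:
  assumes "v $ 2 = 0" "v $ 3 = 0"
  shows "eval3 (pdiff i (pdiff j cubic_equation)) v = (if i = 3 \<and> j = 3 then 54 * v $ 1 else 0)"
  using exhaust_3[of i] exhaust_3[of j] assms
  by (auto simp: cubic_equation_eq pdiff_add pdiff_single eval3_eq
      eval3.subst3_0 eval3.subst3_add eval3.subst3_mon)

section \<open>Points and lines\<close>

lemma mk_proj_eq_iff:
  assumes "u \<noteq> 0" "v \<noteq> 0"
  shows "mk_proj u = mk_proj v \<longleftrightarrow> (\<exists>c. c \<noteq> 0 \<and> v = c *s u)"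
proof -
  \<comment> \<open>The quotient is partial; reflexivity certifies that the nonzero vectors lie in
    its domain.\<close>
  have refl: "proj_rel w w" if "w \<noteq> 0" for w :: "'a ^ 'b"
    using that by (auto simp: proj_rel_def intro!: exI[of _ 1])
  show ?thesis
    using Quotient3_rel[OF Quotient3_proj, of u v] refl[OF assms(1)] refl[OF assms(2)] assms
    by (auto simp: proj_rel_def)
qed

lemma proj_exhaust:
  obtains v where "v \<noteq> 0" "P = mk_proj v"
  by (induction P rule: proj.abs_induct) (auto simp: proj_rel_def)

lemma smult_eq_0_iff: "c *s v = 0 \<longleftrightarrow> c = 0 \<or> v = 0" for v :: "'k::field ^ 'n"
  by (auto simp: vec_eq_iff)

lemma coords_mk_proj:
  assumes "v \<noteq> 0"
  shows "coords (mk_proj v) = {c *s v | c. c \<noteq> 0}"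
proof -
  have "w \<noteq> 0 \<and> mk_proj w = mk_proj v \<longleftrightarrow> (\<exists>c. w = c *s v \<and> c \<noteq> 0)" for w
    using mk_proj_eq_iff[OF assms, of w] assms
    by (auto simp: smult_eq_0_iff eq_commute[of "mk_proj w"])
  then show ?thesis by (simp add: coords_def)
qed

text \<open>Residual facts left when a condition quantified over all nonzero scalars turns out not
  to depend on the scalar.\<close>

lemma all_eq_0_iff: "(\<forall>c::'a::zero_neq_one. c = 0) \<longleftrightarrow> False" "\<exists>c::'a. c \<noteq> 0"
  by (auto intro: exI[of _ 1])

lemma ball_coords_mk_proj:
  "v \<noteq> 0 \<Longrightarrow> (\<forall>w\<in>coords (mk_proj v). Q w) \<longleftrightarrow> (\<forall>c. c \<noteq> 0 \<longrightarrow> Q (c *s v))"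
  by (auto simp: coords_mk_proj)

lemma lies_on_mk_proj:
  assumes "v \<noteq> 0" "l \<noteq> 0"
  shows "lies_on (mk_proj v) (mk_proj l) \<longleftrightarrow> l $ 1 * v $ 1 + l $ 2 * v $ 2 + l $ 3 * v $ 3 = 0"
proof -
  have "(\<Sum>i\<in>UNIV. (c *s l) $ i * (d *s v) $ i) =
      c * d * (l $ 1 * v $ 1 + l $ 2 * v $ 2 + l $ 3 * v $ 3)" for c d
    by (simp add: sum_3 algebra_simps)
  then show ?thesis
    using assms
    by (simp add: lies_on_def ball_coords_mk_proj all_eq_0_iff del: vector_smult_component)
qed

text \<open>The definite description is resolved without a general invariance theorem:
  \<open>ord\<close> makes all admissible parametrizations give \<open>m\<close>, and
  \<open>r\<close> shows that one exists.\<close>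

lemma intersection_mult_eqI:
  assumes "p \<noteq> 0" "l \<noteq> 0" and P: "l $ 1 * p $ 1 + l $ 2 * p $ 2 + l $ 3 * p $ 3 = 0"
    and ex: "l $ 1 * r $ 1 + l $ 2 * r $ 2 + l $ 3 * r $ 3 = 0" "\<And>c. r \<noteq> c *s p"
    and ord: "\<And>c q. c \<noteq> 0 \<Longrightarrow> l $ 1 * q $ 1 + l $ 2 * q $ 2 + l $ 3 * q $ 3 = 0 \<Longrightarrow>
      (\<And>c. q \<noteq> c *s p) \<Longrightarrow> vanishing_order (restrict_line F (c *s p) q) = m"
  shows "intersection_mult F (mk_proj l) (mk_proj p) = m"
proof -
  have nz: "q \<noteq> 0" if "\<And>c. q \<noteq> c *s p" for q
    using that[of 0] by simp
  have neq: "mk_proj q \<noteq> mk_proj p \<longleftrightarrow> (\<forall>c. q \<noteq> c *s p)" if "q \<noteq> 0" for q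
  proof -
    have "mk_proj q = mk_proj p \<longleftrightarrow> (\<exists>c. c \<noteq> 0 \<and> q = c *s p)"
      using mk_proj_eq_iff[OF \<open>p \<noteq> 0\<close> that] by (simp only: eq_commute[of "mk_proj q"])
    also have "\<dots> \<longleftrightarrow> (\<exists>c. q = c *s p)"
      using that by auto
    finally show ?thesis by simp
  qed
  have "(\<exists>Q. Q \<noteq> mk_proj p \<and> lies_on Q (mk_proj l) \<and> (\<exists>p'\<in>coords (mk_proj p).
      \<exists>q\<in>coords Q. m' = vanishing_order (restrict_line F p' q))) \<longleftrightarrow> m' = m" for m'
  proof
    assume "\<exists>Q. Q \<noteq> mk_proj p \<and> lies_on Q (mk_proj l) \<and> (\<exists>p'\<in>coords (mk_proj p).
      \<exists>q\<in>coords Q. m' = vanishing_order (restrict_line F p' q))"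
    then obtain c q where "c \<noteq> 0" "q \<noteq> 0" "mk_proj q \<noteq> mk_proj p" "lies_on (mk_proj q) (mk_proj l)"
        "m' = vanishing_order (restrict_line F (c *s p) q)"
      using \<open>p \<noteq> 0\<close> by (auto simp: coords_mk_proj) (auto simp: coords_def)
    then show "m' = m"
      using ord[of c q] neq lies_on_mk_proj[of q l] \<open>l \<noteq> 0\<close> by blast
  next
    assume m': "m' = m"
    have "r \<noteq> 0" using nz ex by blast
    have "vanishing_order (restrict_line F (1 *s p) r) = m"
      using ord[of 1 r] ex by simp
    moreover have "mk_proj r \<noteq> mk_proj p" "lies_on (mk_proj r) (mk_proj l)"
      using neq lies_on_mk_proj[of r l] \<open>r \<noteq> 0\<close> \<open>l \<noteq> 0\<close> ex by blast+
    moreover have "p \<in> coords (mk_proj p)" "r \<in> coords (mk_proj r)"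
      using \<open>p \<noteq> 0\<close> \<open>r \<noteq> 0\<close> by (auto simp: coords_def)
    ultimately show "\<exists>Q. Q \<noteq> mk_proj p \<and> lies_on Q (mk_proj l) \<and> (\<exists>p'\<in>coords (mk_proj p).
      \<exists>q\<in>coords Q. m' = vanishing_order (restrict_line F p' q))"
      unfolding m' by auto
  qed
  moreover have "lies_on (mk_proj p) (mk_proj l)"
    using P lies_on_mk_proj \<open>p \<noteq> 0\<close> \<open>l \<noteq> 0\<close> by blast
  ultimately show ?thesis
    by (simp add: intersection_mult_def)
qed

text \<open>Split off t^2 or t^3; the cofactor has nonzero constant term. This shape covers lines
  through the cusp and tangent lines alike, as neither restriction has terms below t^2.\<close>

lemma vanishing_order_cubic:
  fixes a b :: "'k::field"
  assumes "a \<noteq> 0 \<or> b \<noteq> 0"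
  shows "vanishing_order [:0, 0, a, b:] = (if a = 0 then 3 else 2)"
proof -
  have *: "order 0 ([:0, 1:] ^ n :: 'k poly) = n" for n
    using order_power_n_n[of "0::'k" n] by simp
  show ?thesis
  proof (cases "a = 0")
    case True
    have "[:0, 0, a, b:] = [:0, 1:] ^ 3 * [:b:]"
      using True by (simp add: numeral_3_eq_3)
    then have "order 0 [:0, 0, a, b:] = 3"
      using True assms * by (simp add: order_smult)
    then show ?thesis using True assms by (simp add: vanishing_order_def numeral_eq_enat)
  next
    case False
    have "[:0, 0, a, b:] = [:0, 1:] ^ 2 * [:a, b:]"
      by (simp add: numeral_2_eq_2)
    moreover have "order 0 ([:0, 1:] ^ 2 * [:a, b:]) =
        order 0 ([:0, 1:] ^ 2 :: 'k poly) + order 0 [:a, b:]"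
      using False by (intro order_mult) (simp only: mult_eq_0_iff power_eq_0_iff pCons_eq_0_iff, simp)
    ultimately have "order 0 [:0, 0, a, b:] = 2"
      using False by (simp add: * order_0I)
    then show ?thesis using False by (simp add: vanishing_order_def numeral_eq_enat)
  qed
qed

section \<open>The parametrized cubic\<close>

text \<open>The image of (1 : s) under the parametrization.\<close>

definition cubic_point :: "'k::field_char_0 \<Rightarrow> 'k ^ 3" where
  "cubic_point s = vector [3 * s\<^sup>2 + s ^ 3, 3 * s, 1]"

text \<open>The gradient of the equation at \<open>cubic_point s\<close>, divided by 27.\<close>

definition cubic_tangent :: "'k::field_char_0 \<Rightarrow> 'k ^ 3" where
  "cubic_tangent s = vector [1, - 2 * s - s\<^sup>2, 3 * s\<^sup>2 + 2 * s ^ 3]"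

lemma cubic_point_nth [simp]:
  "cubic_point s $ 1 = 3 * s\<^sup>2 + s ^ 3" "cubic_point s $ 2 = 3 * s" "cubic_point s $ 3 = 1"
  by (simp_all add: cubic_point_def vector_3)

lemma cubic_tangent_nth [simp]:
  "cubic_tangent s $ 1 = 1" "cubic_tangent s $ 2 = - 2 * s - s\<^sup>2"
  "cubic_tangent s $ 3 = 3 * s\<^sup>2 + 2 * s ^ 3"
  by (simp_all add: cubic_tangent_def vector_3)

lemma cubic_nonzero [simp]: "cubic_point s \<noteq> 0" "cubic_tangent s \<noteq> 0"
  by (simp_all add: vec3_eq_iff)

abbreviation (input) cusp_point :: "'k::field_char_0 ^ 3" where
  "cusp_point \<equiv> vector [1, 0, 0]"

lemma cusp_point_nonzero [simp]: "cusp_point \<noteq> 0"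
  by (simp add: vec3_eq_iff vector_3)

lemma eval3_cubic_equation_smult:
  "eval3 cubic_equation (c *s v) = c ^ 3 * eval3 cubic_equation v"
  by (simp add: eval3_cubic_equation algebra_simps power2_eq_square power3_eq_cube)

lemma gradient_cubic_equation_smult:
  "gradient cubic_equation (c *s v) = c\<^sup>2 *s gradient cubic_equation v"
  by (simp add: gradient_cubic_equation vec3_eq_iff vector_3 algebra_simps power2_eq_square)

text \<open>For a2 = 0 the equation forces a1 = 0; for a2 nonzero it is linear in a0 with invertible
  coefficient, so a1 and a2 determine a0.\<close>

lemma eval3_cubic_equation_eq_0_iff:
  "eval3 cubic_equation v = 0 \<longleftrightarrow> (\<exists>c. v = c *s cusp_point) \<or> (\<exists>c s. c \<noteq> 0 \<and> v = c *s cubic_point s)"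
  (is "_ \<longleftrightarrow> ?R")
proof
  assume v: "eval3 cubic_equation v = 0"
  show ?R
  proof (cases "v $ 3 = 0")
    case True
    with v have "v = v $ 1 *s cusp_point"
      by (simp add: eval3_cubic_equation vec3_eq_iff vector_3)
    then show ?thesis by blast
  next
    case False
    \<comment> \<open>Read off from the ratio 3 s : 1 of the last two coordinates of
      \<open>cubic_point s\<close>.\<close>
    define s where "s = v $ 2 / (3 * v $ 3)"
    have v2: "v $ 2 = 3 * v $ 3 * s"
      using False by (simp add: s_def)
    have "27 * (v $ 3)\<^sup>2 * (v $ 1 - v $ 3 * (3 * s\<^sup>2 + s ^ 3)) = 0"
      using v unfolding eval3_cubic_equation v2
      by (simp add: algebra_simps power2_eq_square power3_eq_cube)
    with False v2 have "v = v $ 3 *s cubic_point s"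
      by (simp add: vec3_eq_iff)
    with False show ?thesis by blast
  qed
next
  assume ?R
  moreover have "eval3 cubic_equation (cubic_point s) = 0" for s :: 'a
    by (simp add: eval3_cubic_equation algebra_simps power2_eq_square power3_eq_cube)
  moreover have "eval3 cubic_equation (cusp_point :: 'a ^ 3) = 0"
    by (simp add: eval3_cubic_equation vector_3)
  ultimately show "eval3 cubic_equation v = 0"
    by (auto simp: eval3_cubic_equation_smult)
qed

section \<open>The point set of the curve\<close>

lemma mk_proj_smult: "mk_proj (c *s v) = mk_proj v" if "c \<noteq> 0" "v \<noteq> 0"
  using mk_proj_eq_iff[of v "c *s v"] that by (auto simp: smult_eq_0_iff)

lemma mem_zero_locus_cubic_iff:
  "R \<in> zero_locus cubic_equation \<longleftrightarrow> R = mk_proj cusp_point \<or> (\<exists>s. R = mk_proj (cubic_point s))"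
proof -
  obtain v where v: "v \<noteq> 0" "R = mk_proj v" by (rule proj_exhaust)
  have "R \<in> zero_locus cubic_equation \<longleftrightarrow> eval3 cubic_equation v = 0"
    using v by (simp add: zero_locus_def ball_coords_mk_proj eval3_cubic_equation_smult all_eq_0_iff)
  also have "\<dots> \<longleftrightarrow> (\<exists>c. c \<noteq> 0 \<and> v = c *s cusp_point) \<or> (\<exists>s c. c \<noteq> 0 \<and> v = c *s cubic_point s)"
    using v by (auto simp: eval3_cubic_equation_eq_0_iff)
  also have "\<dots> \<longleftrightarrow> mk_proj cusp_point = R \<or> (\<exists>s. mk_proj (cubic_point s) = R)"
    using v by (simp add: mk_proj_eq_iff)
  finally show ?thesis by (simp add: eq_commute[of R])
qed

text \<open>By homogeneity a parameter normalizes to (0 : 1), which gives the cusp, or to (1 : s)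
  with s the ratio of its coordinates.\<close>

lemma range_cubic_param: "range cubic_param = zero_locus cubic_equation"
proof (intro set_eqI)
  fix R :: "'a proj_plane"
  have param: "cubic_param (mk_proj v) = mk_proj (vector [3 * v $ 1 * (v $ 2)\<^sup>2 + (v $ 2) ^ 3, 3 * (v $ 1)\<^sup>2 * v $ 2, (v $ 1) ^ 3])"
    if "v \<noteq> 0" for v :: "'a ^ 2"
    using that by (intro cubic_param.abs_eq) (auto simp: proj_rel_def intro!: exI[of _ 1])
  show "R \<in> range cubic_param \<longleftrightarrow> R \<in> zero_locus cubic_equation"
    unfolding mem_zero_locus_cubic_iff
  proof
    assume "R \<in> range cubic_param"
    then obtain v where v: "v \<noteq> 0" "R = cubic_param (mk_proj v)"
      by (metis imageE proj_exhaust)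
    show "R = mk_proj cusp_point \<or> (\<exists>s. R = mk_proj (cubic_point s))"
    proof (cases "v $ 1 = 0")
      case True
      with v have "v $ 2 \<noteq> 0" by (auto simp: vec_eq_iff forall_2)
      moreover have "R = mk_proj ((v $ 2) ^ 3 *s cusp_point)"
        unfolding v(2) param[OF v(1)] using True
        by (intro arg_cong[where f = mk_proj]) (simp add: vec3_eq_iff vector_3)
      ultimately show ?thesis by (simp add: mk_proj_smult)
    next
      case False
      have "R = mk_proj ((v $ 1) ^ 3 *s cubic_point (v $ 2 / v $ 1))"
        unfolding v(2) param[OF v(1)] using False
        by (intro arg_cong[where f = mk_proj])
          (simp add: vec3_eq_iff vector_3 field_simps power2_eq_square power3_eq_cube)
      with False show ?thesis by (auto simp: mk_proj_smult)
    qed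
  next
    assume "R = mk_proj cusp_point \<or> (\<exists>s. R = mk_proj (cubic_point s))"
    then show "R \<in> range cubic_param"
    proof (elim disjE exE)
      assume "R = mk_proj cusp_point"
      also have "\<dots> = cubic_param (mk_proj (vector [0, 1]))"
        by (subst param) (simp_all add: vec_eq_iff forall_2 forall_3 vector_2 vector_3)
      finally show ?thesis by blast
    next
      fix s assume "R = mk_proj (cubic_point s)"
      also have "\<dots> = cubic_param (mk_proj (vector [1, s]))"
        by (subst param) (simp_all add: vec_eq_iff forall_2 forall_3 vector_2 cubic_point_def)
      finally show ?thesis by blast
    qed
  qed
qed

section \<open>Singular and smooth points\<close>

lemma gradient_cusp_point: "gradient cubic_equation cusp_point = 0"
  by (simp add: gradient_cubic_equation vec3_eq_iff vector_3)

lemma gradient_cubic_point: "gradient cubic_equation (cubic_point s) = 27 *s cubic_tangent s"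
  by (simp add: gradient_cubic_equation vec3_eq_iff vector_3 algebra_simps power2_eq_square power3_eq_cube)

lemma cubic_points_mem_zero_locus:
  "mk_proj cusp_point \<in> zero_locus cubic_equation"
  "mk_proj (cubic_point s) \<in> zero_locus cubic_equation"
  by (auto simp: mem_zero_locus_cubic_iff)

lemma
  shows singular_cusp_point: "singular_point cubic_equation (mk_proj cusp_point)"
    and not_smooth_cusp_point: "\<not> smooth_point cubic_equation (mk_proj cusp_point)"
    and smooth_cubic_point: "smooth_point cubic_equation (mk_proj (cubic_point s))"
    and not_singular_cubic_point: "\<not> singular_point cubic_equation (mk_proj (cubic_point s))"
  by (simp_all add: singular_point_def smooth_point_def cubic_points_mem_zero_locus
      ball_coords_mk_proj gradient_cubic_equation_smult gradient_cusp_point gradient_cubic_point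
      smult_eq_0_iff all_eq_0_iff)

lemma singular_point_cubic_iff: "singular_point cubic_equation R \<longleftrightarrow> R = mk_proj cusp_point"
proof
  assume R: "singular_point cubic_equation R"
  then have "R \<in> zero_locus cubic_equation" by (simp add: singular_point_def)
  with R show "R = mk_proj cusp_point"
    using not_singular_cubic_point by (auto simp: mem_zero_locus_cubic_iff)
qed (simp add: singular_cusp_point)

lemma smooth_point_cubic_iff:
  "smooth_point cubic_equation R \<longleftrightarrow> (\<exists>s. R = mk_proj (cubic_point s))"
proof
  assume R: "smooth_point cubic_equation R"
  then have "R \<in> zero_locus cubic_equation" by (simp add: smooth_point_def)
  with R show "\<exists>s. R = mk_proj (cubic_point s)"
    using not_smooth_cusp_point by (auto simp: mem_zero_locus_cubic_iff)
qed (auto simp: smooth_cubic_point)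

section \<open>Restrictions to lines, tangent lines and the flex\<close>

lemma tangent_line_cubic_iff:
  "tangent_line cubic_equation (mk_proj (cubic_point s)) L \<longleftrightarrow> L = mk_proj (cubic_tangent s)"
  by (simp add: tangent_line_def smooth_cubic_point ball_coords_mk_proj mk_proj_smult
      gradient_cubic_equation_smult gradient_cubic_point vector_smult_assoc all_eq_0_iff)

text \<open>The cusp is singular, so orders 0 and 1 are absent; order 2 is the tangent cone, and
  order 3 is the cubic at \<open>q\<close>.\<close>

lemma restrict_line_cusp_point:
  "restrict_line cubic_equation (c *s cusp_point) q =
     [:0, 0, 27 * c * (q $ 3)\<^sup>2, 27 * q $ 1 * (q $ 3)\<^sup>2 - 9 * (q $ 2)\<^sup>2 * q $ 3 - q $ 2 ^ 3:]"
  \<comment> \<open>The field is infinite, so polynomials may be compared as functions.\<close>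
  unfolding poly_eq_poly_eq_iff[symmetric] restrict_line_cubic_equation
  by (simp add: fun_eq_iff vector_3 algebra_simps power2_eq_square power3_eq_cube)

text \<open>The tangent line is spanned by \<open>cubic_point s\<close> and \<open>(2 s + s\<^sup>2, 1, 0)\<close>. In the
  corresponding coordinates \<open>x\<close>, \<open>y\<close> the cubic restricts to \<open>- y\<^sup>2 (9 (1 + s) x + y)\<close>, which
  is where the flex parameter \<open>s = - 1\<close> comes from.\<close>

lemma restrict_line_cubic_tangent:
  assumes "cubic_tangent s $ 1 * q $ 1 + cubic_tangent s $ 2 * q $ 2 + cubic_tangent s $ 3 * q $ 3 = 0"
  shows "restrict_line cubic_equation (c *s cubic_point s) q =
    (let u = q $ 2 - 3 * s * q $ 3
     in [:0, 0, - 9 * u\<^sup>2 * (1 + s) * c, - u\<^sup>2 * (9 * (1 + s) * q $ 3 + u):])"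
proof -
  have q1: "q $ 1 = (2 * s + s\<^sup>2) * q $ 2 - (3 * s\<^sup>2 + 2 * s ^ 3) * q $ 3"
    using assms by (simp add: algebra_simps)
  show ?thesis
    unfolding poly_eq_poly_eq_iff[symmetric] restrict_line_cubic_equation Let_def q1
    by (simp add: fun_eq_iff algebra_simps power2_eq_square power3_eq_cube)
qed

text \<open>The t^2 coefficient is a nonzero multiple of 1 + s; at s = -1 the t^3 coefficient is
  -u^3, again nonzero.\<close>

lemma intersection_mult_cubic_tangent:
  "intersection_mult cubic_equation (mk_proj (cubic_tangent s)) (mk_proj (cubic_point s)) =
     (if s = - 1 then 3 else 2)"
\<comment> \<open>\<open>r\<close> is where the tangent meets the line a2 = 0.\<close>
proof (rule intersection_mult_eqI[where r = "vector [2 * s + s\<^sup>2, 1, 0]"])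
  fix c :: 'a and q :: "'a ^ 3"
  assume "c \<noteq> 0"
    and q: "cubic_tangent s $ 1 * q $ 1 + cubic_tangent s $ 2 * q $ 2 + cubic_tangent s $ 3 * q $ 3 = 0"
    and neq: "\<And>c. q \<noteq> c *s cubic_point s"
  \<comment> \<open>The coordinate of \<open>q\<close> along \<open>r\<close> in the basis
    \<open>cubic_point s\<close>, \<open>r\<close> of the tangent; it vanishes only on multiples of
    \<open>cubic_point s\<close>.\<close>
  define u where "u = q $ 2 - 3 * s * q $ 3"
  have "u \<noteq> 0"
  proof
    assume "u = 0"
    then have q2: "q $ 2 = 3 * s * q $ 3" by (simp add: u_def)
    have "q $ 1 = q $ 3 * (3 * s\<^sup>2 + s ^ 3)"
      using q unfolding q2 by (simp add: algebra_simps power2_eq_square power3_eq_cube)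
    with q2 have "q = q $ 3 *s cubic_point s"
      by (simp add: vec3_eq_iff)
    with neq show False by blast
  qed
  then have "vanishing_order [:0, 0, - 9 * u\<^sup>2 * (1 + s) * c, - u\<^sup>2 * (9 * (1 + s) * q $ 3 + u):] =
      (if s = - 1 then 3 else 2)"
    using \<open>c \<noteq> 0\<close> by (subst vanishing_order_cubic) (auto simp: add_eq_0_iff)
  then show "vanishing_order (restrict_line cubic_equation (c *s cubic_point s) q) =
      (if s = - 1 then 3 else 2)"
    using restrict_line_cubic_tangent[OF q, of c] by (simp add: u_def Let_def)
qed (auto simp: vec3_eq_iff vector_3 algebra_simps power2_eq_square power3_eq_cube)

text \<open>Smooth points are the \<open>cubic_point s\<close>, each with a single tangent, so only
  s = -1 qualifies.\<close>

lemma flex_point_cubic_iff: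
  "flex_point cubic_equation R \<longleftrightarrow> R = mk_proj (vector [2, - 3, 1])"
proof -
  have "cubic_point (- 1) = (vector [2, - 3, 1] :: 'a ^ 3)"
    by (simp add: vec3_eq_iff vector_3)
  moreover have "flex_point cubic_equation (mk_proj (cubic_point s)) \<longleftrightarrow> s = - 1" for s :: 'a
    by (simp add: flex_point_def smooth_cubic_point tangent_line_cubic_iff
        intersection_mult_cubic_tangent)
  moreover have "\<exists>s. R = mk_proj (cubic_point s)" if "flex_point cubic_equation R"
    using that by (simp add: flex_point_def smooth_point_cubic_iff)
  ultimately show ?thesis by metis
qed

section \<open>Lines through the cusp\<close>

lemma intersection_mult_cusp_point:
  fixes l :: "'k::field_char_0 ^ 3"
  assumes "l \<noteq> 0"
  shows "intersection_mult cubic_equation (mk_proj l) (mk_proj cusp_point) =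
    (if l $ 1 \<noteq> 0 then 0 else if l $ 2 = 0 then 3 else 2)"
proof (cases "l $ 1 = 0")
  case False
  then show ?thesis
    \<comment> \<open>Such a line misses the cusp, where the multiplicity is 0 by
      definition.\<close>
    using assms by (simp add: intersection_mult_def lies_on_mk_proj vector_3)
next
  case True
  have "intersection_mult cubic_equation (mk_proj l) (mk_proj cusp_point) =
      (if l $ 2 = 0 then 3 else 2)"
  \<comment> \<open>With \<open>l $ 1 = 0\<close> this \<open>r\<close> solves the equation of the
    line, and it is nonzero because \<open>l\<close> is.\<close>
  proof (rule intersection_mult_eqI[where r = "vector [0, l $ 3, - l $ 2]"])
    fix c :: 'k and q :: "'k ^ 3"
    assume "c \<noteq> 0" and q: "l $ 1 * q $ 1 + l $ 2 * q $ 2 + l $ 3 * q $ 3 = 0"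
      and neq: "\<And>c. q \<noteq> c *s cusp_point"
    have "q $ 2 \<noteq> 0 \<or> q $ 3 \<noteq> 0"
      using neq[of "q $ 1"] by (auto simp: vec3_eq_iff vector_3)
    \<comment> \<open>Both pairs (q2, q3) and (l2, l3) are nonzero and l2 q2 + l3 q3 = 0. Hence the
      t^2 coefficient vanishes exactly on the line a2 = 0.\<close>
    moreover have "q $ 3 = 0 \<longleftrightarrow> l $ 2 = 0"
      using q True assms calculation by (auto simp: vec3_eq_iff)
    ultimately show "vanishing_order (restrict_line cubic_equation (c *s cusp_point) q) =
        (if l $ 2 = 0 then 3 else 2)"
      using \<open>c \<noteq> 0\<close> unfolding restrict_line_cusp_point
      by (subst vanishing_order_cubic) auto
  qed (use True assms in \<open>auto simp: vec3_eq_iff vector_3\<close>)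
  with True show ?thesis by simp
qed

lemma mk_proj_eq_vector_001_iff:
  fixes l :: "'k::field ^ 3"
  assumes "l \<noteq> 0"
  shows "mk_proj l = mk_proj (vector [0, 0, 1]) \<longleftrightarrow> l $ 1 = 0 \<and> l $ 2 = 0"
proof -
  have "mk_proj (vector [0, 0, 1]) = mk_proj l \<longleftrightarrow> (\<exists>c. c \<noteq> 0 \<and> l = c *s vector [0, 0, 1])"
    using assms by (intro mk_proj_eq_iff) (auto simp: vec3_eq_iff vector_3)
  then show ?thesis
    using assms by (auto simp: vec3_eq_iff vector_3)
qed

lemma intersection_mult_cusp_eq_3_iff:
  "intersection_mult cubic_equation L (mk_proj cusp_point) = 3 \<longleftrightarrow> L = mk_proj (vector [0, 0, 1])"
proof -
  obtain l where "l \<noteq> 0" "L = mk_proj l" by (rule proj_exhaust)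
  then show ?thesis
    by (auto simp: intersection_mult_cusp_point mk_proj_eq_vector_001_iff)
qed

lemma cusp_cubic_iff: "cusp cubic_equation R \<longleftrightarrow> R = mk_proj cusp_point"
proof
  assume "cusp cubic_equation R"
  then show "R = mk_proj cusp_point"
    by (auto simp: cusp_def double_tangent_def singular_point_cubic_iff)
next
  assume R: "R = mk_proj cusp_point"
  have nz: "(vector [0, 0, 1] :: 'a ^ 3) \<noteq> 0"
    by (simp add: vec3_eq_iff vector_3)
  have "double_tangent cubic_equation R (mk_proj (vector [0, 0, 1]))"
    unfolding double_tangent_def R singular_point_cubic_iff
      ball_coords_mk_proj[OF nz] ball_coords_mk_proj[OF cusp_point_nonzero]
  proof (intro conjI allI impI refl)
    fix c d :: 'a
    assume "c \<noteq> 0" "d \<noteq> 0"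
    then show "\<exists>e. e \<noteq> 0 \<and> (\<forall>i j. eval3 (pdiff i (pdiff j cubic_equation)) (c *s cusp_point) =
        e * (d *s vector [0, 0, 1]) $ i * (d *s vector [0, 0, 1]) $ j)"
      \<comment> \<open>The only Hessian entry at \<open>c *s cusp_point\<close> is 54 c, while the
        form d a2 contributes d^2.\<close>
      by (intro exI[of _ "54 * c / d\<^sup>2"])
        (simp add: hessian_cubic_equation_cusp forall_3 vector_3 power2_eq_square)
  qed
  then show "cusp cubic_equation R"
    unfolding cusp_def R using intersection_mult_cusp_eq_3_iff by blast
qed

section \<open>The ideal of the curve\<close>

text \<open>Rewriting a1^3 by means of the equation lowers the exponent of a1. The set
  \<open>S\<close> of polynomials that admit a division is closed under sums, so induction on that
  exponent for monomials suffices.\<close>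

lemma cubic_division:
  "\<exists>H R. G = cubic_equation * H + R \<and> (\<forall>m\<in>Poly_Mapping.keys R. Poly_Mapping.lookup m 2 \<le> 2)"
  for G :: "'k::field_char_0 poly3"
proof -
  define red where "red R \<longleftrightarrow> (\<forall>m\<in>Poly_Mapping.keys R. Poly_Mapping.lookup m 2 \<le> 2)"
    for R :: "'k poly3"
  define S where "S = {cubic_equation * H + R | H R. red R}"
  have add: "F + G \<in> S" if FG: "F \<in> S" "G \<in> S" for F G
  proof -
    obtain H R H' R' where "F = cubic_equation * H + R" "G = cubic_equation * H' + R'" "red R" "red R'"
      using FG by (auto simp: S_def)
    moreover from this have "red (R + R')"
      using keys_add[of R R'] by (auto simp: red_def)
    ultimately show ?thesis
      unfolding S_def by (intro CollectI exI[of _ "H + H'"] exI[of _ "R + R'"])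
        (simp add: distrib_left ac_simps)
  qed
  have mult: "cubic_equation * H \<in> S" for H
    unfolding S_def by (intro CollectI exI[of _ H] exI[of _ 0]) (simp add: red_def)
  have mon: "Poly_Mapping.single (mon i j k) c \<in> S" for i j k c
  proof (induction j arbitrary: i k c rule: less_induct)
    case (less j)
    show ?case
    proof (cases "j \<le> 2")
      case True
      then show ?thesis
        unfolding S_def
        by (intro CollectI exI[of _ 0] exI[of _ "Poly_Mapping.single (mon i j k) c"])
          (simp add: red_def)
    next
      case False
      define n where "n = j - 3"
      have j: "j = n + 3" using False by (simp add: n_def)
      \<comment> \<open>The remaining terms have a1-exponents n and n + 2, both below j = n +
        3.\<close>
      have "Poly_Mapping.single (mon i j k) c =
          cubic_equation * Poly_Mapping.single (mon i n k) (- c)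
          + (Poly_Mapping.single (mon (i + 1) n (k + 2)) (27 * c)
          + Poly_Mapping.single (mon i (n + 2) (k + 1)) (- 9 * c))"
        unfolding cubic_equation_eq j
        by (simp add: distrib_right mult_single single_uminus left_diff_distrib add.commute)
      then show ?thesis
        using add[OF mult add[OF less less]] j by simp
    qed
  qed
  have "G \<in> S"
  proof (induction G rule: poly_mapping_single_add_induct)
    case (single m c)
    then show ?case using mon by (metis mon_exhaust)
  qed (rule add)
  then show ?thesis by (auto simp: S_def red_def)
qed

text \<open>\<open>t \<mapsto> t\<^sup>N *s cubic_point t\<close>. Using a large power of the parameter as the scaling factor
  keeps the images of distinct reduced monomials in distinct degrees.\<close>

definition cone_arc :: "nat \<Rightarrow> 3 \<Rightarrow> 'k::field_char_0 poly" where
  "cone_arc N i = monom 1 N * (if i = 1 then monom 3 2 + monom 1 3 else if i = 2 then monom 3 1 else 1)"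

section \<open>Values and degrees along the arcs\<close>

lemma poly_subst3_cone_arc:
  "poly (poly_hom.subst3 (cone_arc N) G) s = eval3 G (s ^ N *s cubic_point s)"
proof -
  have "(\<chi> i. poly (cone_arc N i) s) = s ^ N *s cubic_point s"
    by (simp add: vec3_eq_iff cone_arc_def poly_monom)
  then show ?thesis by (simp add: poly_subst3)
qed

lemma subst3_cone_arc_cubic_equation: "poly_hom.subst3 (cone_arc N) cubic_equation = 0"
  unfolding subst3_cubic_equation[OF poly_hom.coeff_hom_axioms] poly_eq_poly_eq_iff[symmetric]
  by (simp add: fun_eq_iff cone_arc_def poly_monom algebra_simps power2_eq_square power3_eq_cube)

text \<open>The arc's coordinates have degrees N + 3, N + 1 and N, and degrees add in
  products.\<close>

lemma cone_arc_monomial: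
  assumes "c \<noteq> 0"
  shows "degree (poly_hom.subst3 (cone_arc N) (Poly_Mapping.single (mon i j k) c)) =
      N * (i + j + k) + 3 * i + j"
    and "poly_hom.subst3 (cone_arc N) (Poly_Mapping.single (mon i j k) c) \<noteq> 0"
proof -
  have *: "degree (monom 3 2 + monom (1::'a) 3) = 3"
    by (subst degree_add_eq_right) (simp_all add: degree_monom_eq)
  then have [simp]: "monom 3 2 + monom (1::'a) 3 \<noteq> 0" by auto
  show "degree (poly_hom.subst3 (cone_arc N) (Poly_Mapping.single (mon i j k) c)) =
      N * (i + j + k) + 3 * i + j"
    using assms
    by (simp add: poly_hom.subst3_mon cone_arc_def degree_mult_eq degree_power_eq degree_monom_eq *
        monom_eq_0_iff) (simp add: algebra_simps)
  show "poly_hom.subst3 (cone_arc N) (Poly_Mapping.single (mon i j k) c) \<noteq> 0"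
    using assms by (simp add: poly_hom.subst3_mon cone_arc_def monom_eq_0_iff)
qed

text \<open>Distinct reduced monomials get distinct degrees, so the term of top degree cannot
  cancel.\<close>

lemma subst3_cone_arc_nonzero:
  assumes "R \<noteq> 0"
    and red: "\<And>m. m \<in> Poly_Mapping.keys R \<Longrightarrow> Poly_Mapping.lookup m 2 \<le> 2"
    and N: "\<And>m. m \<in> Poly_Mapping.keys R \<Longrightarrow>
      3 * Poly_Mapping.lookup m 1 + Poly_Mapping.lookup m 2 < N"
  shows "poly_hom.subst3 (cone_arc N) R \<noteq> 0"
proof -
  define w where "w m = N * (Poly_Mapping.lookup m 1 + Poly_Mapping.lookup m 2 + Poly_Mapping.lookup m 3)
    + 3 * Poly_Mapping.lookup m 1 + Poly_Mapping.lookup m 2" for m :: "3 \<Rightarrow>\<^sub>0 nat"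
  define T where "T m = poly_hom.subst3 (cone_arc N)
    (Poly_Mapping.single m (Poly_Mapping.lookup R m))" for m
  have T: "degree (T m) = w m" "T m \<noteq> 0" if "m \<in> Poly_Mapping.keys R" for m
  proof -
    obtain i j k where m: "m = mon i j k" by (rule mon_exhaust)
    from that have "Poly_Mapping.lookup R m \<noteq> 0" by (simp add: in_keys_iff)
    from cone_arc_monomial[OF this, of N i j k] show "degree (T m) = w m" "T m \<noteq> 0"
      by (simp_all add: T_def w_def m)
  qed
  have inj: "inj_on w (Poly_Mapping.keys R)"
  proof (rule inj_onI)
    fix m n
    assume mn: "m \<in> Poly_Mapping.keys R" "n \<in> Poly_Mapping.keys R" "w m = w n"
    obtain i j k where m: "m = mon i j k" by (rule mon_exhaust)
    obtain i' j' k' where n: "n = mon i' j' k'" by (rule mon_exhaust)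
    have lt: "3 * i + j < N" "3 * i' + j' < N"
      using N[OF mn(1)] N[OF mn(2)] by (simp_all add: m n)
    have eq: "N * (i + j + k) + (3 * i + j) = N * (i' + j' + k') + (3 * i' + j')"
      using mn(3) by (simp add: w_def m n add.assoc)
    \<comment> \<open>Division by \<open>N\<close> separates the weight: the remainder is 3 i + j,
      the quotient the total degree.\<close>
    from arg_cong[OF eq, of "\<lambda>x. x mod N"] lt have e: "3 * i + j = 3 * i' + j'"
      by simp
    with eq lt have d: "i + j + k = i' + j' + k'"
      by simp
    have "j \<le> 2" "j' \<le> 2"
      using red[OF mn(1)] red[OF mn(2)] by (simp_all add: m n)
    \<comment> \<open>Since j is at most 2, it is the remainder of 3 i + j modulo 3.\<close>
    with e have "i = i'" "j = j'" by arith+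
    with d show "m = n" by (simp add: m n)
  qed
  obtain m where m: "m \<in> Poly_Mapping.keys R" "\<And>n. n \<in> Poly_Mapping.keys R \<Longrightarrow> w n \<le> w m"
  proof -
    have "Poly_Mapping.keys R \<noteq> {}" using \<open>R \<noteq> 0\<close> by simp
    then have "Max (w ` Poly_Mapping.keys R) \<in> w ` Poly_Mapping.keys R"
      by (intro Max_in) auto
    then obtain m where "m \<in> Poly_Mapping.keys R" "w m = Max (w ` Poly_Mapping.keys R)"
      by force
    with that[of m] show ?thesis by simp
  qed
  have "coeff (T n) (w m) = 0" if "n \<in> Poly_Mapping.keys R" "n \<noteq> m" for n
  proof -
    have "w n < w m"
      using that m inj by (metis inj_onD le_neq_implies_less)
    with that T show ?thesis by (simp add: coeff_eq_0)
  qed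
  moreover have "poly_hom.subst3 (cone_arc N) R = (\<Sum>n\<in>Poly_Mapping.keys R. T n)"
    unfolding T_def poly_hom.subst3_single by (simp add: poly_hom.subst3_def)
  ultimately have "coeff (poly_hom.subst3 (cone_arc N) R) (w m) = coeff (T m) (w m)"
    using m(1) by (simp add: coeff_sum sum.remove[of _ m])
  moreover have "coeff (T m) (w m) \<noteq> 0"
    using T[OF m(1)] leading_coeff_0_iff by metis
  ultimately show ?thesis by auto
qed

text \<open>The bound depends on the remainder of \<open>G\<close>; allowing every larger
  \<open>N\<close> lets two polynomials share one arc.\<close>

lemma cubic_dvd_if_subst3_cone_arc_eq_0:
  fixes G :: "'k::field_char_0 poly3"
  obtains N0 where "\<And>N. N \<ge> N0 \<Longrightarrow> poly_hom.subst3 (cone_arc N) G = 0 \<Longrightarrow> cubic_equation dvd G"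
proof -
  obtain H R where G: "G = cubic_equation * H + R"
    and red: "\<And>m. m \<in> Poly_Mapping.keys R \<Longrightarrow> Poly_Mapping.lookup m 2 \<le> 2"
    using cubic_division[of G] by blast
  \<comment> \<open>A sum of naturals bounds each summand; \<open>Suc\<close> makes the bound
    strict.\<close>
  define N0 where "N0 = Suc (\<Sum>m\<in>Poly_Mapping.keys R. 3 * Poly_Mapping.lookup m 1 + Poly_Mapping.lookup m 2)"
  have "cubic_equation dvd G" if "N \<ge> N0" "poly_hom.subst3 (cone_arc N) G = 0" for N
  proof -
    from that(2) have "poly_hom.subst3 (cone_arc N) R = 0"
      by (simp add: G subst3_cone_arc_cubic_equation poly_hom.subst3_add poly_hom.subst3_mult)
    moreover have "3 * Poly_Mapping.lookup m 1 + Poly_Mapping.lookup m 2 < N"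
      if "m \<in> Poly_Mapping.keys R" for m
      using member_le_sum[OF that, of "\<lambda>m. 3 * Poly_Mapping.lookup m 1 + Poly_Mapping.lookup m 2"]
        \<open>N \<ge> N0\<close> by (simp add: N0_def)
    ultimately have "R = 0"
      using subst3_cone_arc_nonzero red by blast
    then show ?thesis by (simp add: G)
  qed
  with that show ?thesis by blast
qed

text \<open>Substituting the arc kills the equation and maps into a domain, so one factor goes to 0;
  \<open>N\<close> lies above both thresholds.\<close>

lemma cubic_equation_prime:
  assumes "cubic_equation dvd A * B"
  shows "cubic_equation dvd A \<or> cubic_equation dvd (B :: 'k::field_char_0 poly3)"
proof -
  obtain N1 N2 where N1: "\<And>N. N \<ge> N1 \<Longrightarrow> poly_hom.subst3 (cone_arc N) A = 0 \<Longrightarrow> cubic_equation dvd A"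
    and N2: "\<And>N. N \<ge> N2 \<Longrightarrow> poly_hom.subst3 (cone_arc N) B = 0 \<Longrightarrow> cubic_equation dvd B"
    using cubic_dvd_if_subst3_cone_arc_eq_0 by metis
  define N where "N = max N1 N2"
  obtain H where "A * B = cubic_equation * H" using assms by (elim dvdE)
  then have "poly_hom.subst3 (cone_arc N) A * poly_hom.subst3 (cone_arc N) B = 0"
    by (simp add: subst3_cone_arc_cubic_equation poly_hom.subst3_mult flip: poly_hom.subst3_mult[of _ A])
  with N1[of N] N2[of N] show ?thesis by (auto simp: N_def)
qed

lemma irreducible_cubic_equation: "irreducible (cubic_equation :: 'k::field_char_0 poly3)"
proof (rule irreducibleI)
  \<comment> \<open>The value is 27, nonzero in characteristic 0.\<close>
  have "eval3 cubic_equation (vector [1, 0, 1]) \<noteq> (0 :: 'k)"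
    by (simp add: eval3_cubic_equation vector_3)
  then show nz: "cubic_equation \<noteq> (0 :: 'k poly3)"
    by (auto simp: eval3_def)
  show "\<not> (cubic_equation :: 'k poly3) dvd 1"
  proof
    assume "(cubic_equation :: 'k poly3) dvd 1"
    then obtain G :: "'k poly3" where G: "1 = cubic_equation * G" by (elim dvdE)
    \<comment> \<open>The equation vanishes at the cusp, so a unit multiple of it cannot be
      1.\<close>
    have "eval3 1 cusp_point = eval3 cubic_equation cusp_point * eval3 G cusp_point"
      unfolding G by (simp only: eval3_eq eval3.subst3_mult)
    then show False
      by (simp add: eval3_eq[of 1] eval3.subst3_1 eval3_cubic_equation vector_3)
  qed
  fix A B :: "'k poly3"
  assume AB: "cubic_equation = A * B"
  then have "cubic_equation dvd A \<or> cubic_equation dvd B"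
    by (intro cubic_equation_prime) simp
  then show "A dvd 1 \<or> B dvd 1"
  proof
    assume "cubic_equation dvd A"
    then obtain H where "A = cubic_equation * H" by (elim dvdE)
    \<comment> \<open>Cancelling the equation shows that the other factor is a unit.\<close>
    with AB have "cubic_equation * 1 = cubic_equation * (B * H)" by (simp add: ac_simps)
    with nz have "1 = B * H" by (simp only: mult_cancel_left) simp
    then show ?thesis by (intro disjI2 dvdI)
  next
    assume "cubic_equation dvd B"
    then obtain H where "B = cubic_equation * H" by (elim dvdE)
    with AB have "cubic_equation * 1 = cubic_equation * (A * H)" by (simp add: ac_simps)
    with nz have "1 = A * H" by (simp only: mult_cancel_left) simp
    then show ?thesis by (intro disjI1 dvdI)
  qed
qed

text \<open>\<open>G\<close> need not be homogeneous, but it vanishes at every nonzero multiple of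
  \<open>cubic_point s\<close>, hence along all the arcs.\<close>

lemma vanishing_ideal_cubic:
  "vanishing_ideal (zero_locus cubic_equation) = {G. cubic_equation dvd (G :: 'k::field_char_0 poly3)}"
proof (intro set_eqI iffI; clarsimp)
  fix G :: "'k poly3"
  assume G: "G \<in> vanishing_ideal (zero_locus cubic_equation)"
  \<comment> \<open>The extra factor t covers s = 0, where the arc may pass through the zero vector,
    which represents no point.\<close>
  have "poly ([:0, 1:] * poly_hom.subst3 (cone_arc N) G) s = 0" for N s
  proof (cases "s = 0")
    case False
    have "mk_proj (cubic_point s) \<in> zero_locus cubic_equation"
      by (auto simp: mem_zero_locus_cubic_iff)
    with G have "\<forall>v\<in>coords (mk_proj (cubic_point s)). eval3 G v = 0"
      by (auto simp: vanishing_ideal_def)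
    with False show ?thesis
      by (simp add: ball_coords_mk_proj poly_subst3_cone_arc)
  qed simp
  then have "[:0, 1:] * poly_hom.subst3 (cone_arc N) G = 0" for N
    unfolding poly_eq_poly_eq_iff[symmetric] by (simp add: fun_eq_iff)
  then have "poly_hom.subst3 (cone_arc N) G = 0" for N
    by (metis mult_eq_0_iff pCons_eq_0_iff one_neq_zero)
  with cubic_dvd_if_subst3_cone_arc_eq_0[of G] show "cubic_equation dvd G"
    by blast
next
  fix G :: "'k poly3"
  assume "cubic_equation dvd G"
  then show "G \<in> vanishing_ideal (zero_locus cubic_equation)"
    by (auto simp: vanishing_ideal_def zero_locus_def eval3_eq eval3.subst3_mult elim!: dvdE)
qed

section \<open>Homogeneity, the line through cusp and flex, and the conclusion\<close>

lemma homogeneous_cubic_equation: "homogeneous 3 cubic_equation"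
proof -
  have "Poly_Mapping.keys (cubic_equation :: 'a poly3) \<subseteq> {mon 1 0 2, mon 0 2 1, mon 0 3 0}"
    unfolding cubic_equation_eq
    by (rule order_trans[OF keys_add] Un_least)+ simp_all
  then show ?thesis by (auto simp: homogeneous_def sum_3)
qed

text \<open>The cusp forces l1 = 0, and then the flex forces l3 = 3 l2.\<close>

lemma line_through_cusp_and_flex:
  "lies_on (mk_proj cusp_point) L \<and> lies_on (mk_proj (vector [2, - 3, 1])) L \<longleftrightarrow>
     L = mk_proj (vector [0, 1, 3] :: 'k::field_char_0 ^ 3)"
proof -
  obtain l where l: "l \<noteq> 0" "L = mk_proj l" by (rule proj_exhaust)
  have nz: "vector [2, - 3, 1] \<noteq> (0 :: 'k ^ 3)" "vector [0, 1, 3] \<noteq> (0 :: 'k ^ 3)"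
    by (simp_all add: vec3_eq_iff vector_3)
  have "lies_on (mk_proj cusp_point) L \<and> lies_on (mk_proj (vector [2, - 3, 1])) L \<longleftrightarrow>
      l = l $ 2 *s vector [0, 1, 3]"
    using l nz by (auto simp: lies_on_mk_proj vec3_eq_iff vector_3 algebra_simps)
  also have "\<dots> \<longleftrightarrow> (\<exists>c. c \<noteq> 0 \<and> l = c *s vector [0, 1, 3])"
    using l(1) by (auto simp: vec3_eq_iff vector_3)
  also have "\<dots> \<longleftrightarrow> L = mk_proj (vector [0, 1, 3])"
    using mk_proj_eq_iff[OF nz(2) l(1)] l(2) by (simp add: eq_commute)
  finally show ?thesis .
qed

theorem lemma4p2:
  fixes C :: "'k::field_char_0 proj_plane set"
    and P Q :: "'k proj_plane" and l1 l2 :: "'k line"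
  assumes "C = range cubic_param"
    and "P = mk_proj (vector [1, 0, 0])"
    and "Q = mk_proj (vector [2, - 3, 1])"
    and "l1 = mk_proj (vector [0, 1, 3])"
    and "l2 = mk_proj (vector [0, 0, 1])"
  shows "curve_given_by C cubic_equation \<and> cuspidal_cubic (cubic_equation :: 'k poly3) \<and>
    {R. cusp (cubic_equation :: 'k poly3) R} = {P} \<and>
    {R. flex_point (cubic_equation :: 'k poly3) R} = {Q} \<and>
    (\<forall>L. lies_on P L \<and> lies_on Q L \<longleftrightarrow> L = l1) \<and>
    (\<forall>L. intersection_mult cubic_equation L P = 3 \<longleftrightarrow> L = l2)"
  using homogeneous_cubic_equation
  by (auto simp: assms curve_given_by_def cuspidal_cubic_def range_cubic_param vanishing_ideal_cubic
      irreducible_cubic_equation cusp_cubic_iff flex_point_cubic_iff line_through_cusp_and_flex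
      intersection_mult_cusp_eq_3_iff)

end
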